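(* Let $a\neq 0$ and $n\geq 1$ be integers such that there exists a positive integer $m$ for which $\{T_n,T_m\}$ is a $D(a)$-pair. Then $T_n$ is an element of infinitely many $D(a)$-triples all of whose elements are triangular numbers.
   Context: For a positive integer $n$, $T_n=\frac{n(n+1)}{2}$ denotes the $n$-th triangular number. For an integer $a\neq 0$, a $D(a)$-$m$-tuple is a set of $m$ distinct positive integers such that the product of any two of its distinct elements increased by $a$ is a perfect square (the square of an integer). A $D(a)$-pair is the case of two elements and a $D(a)$-triple the case of three elements. *)

theory Defs
  imports Main "HOL-Library.Nat_Bijection" "HOL-Computational_Algebra.Nth_Powers"
begin

(* The triangular number T_n is the library's triangle n. *)

definition D_tuple :: "int \<Rightarrow> nat \<Rightarrow> nat set \<Rightarrow> bool" where
  "D_tuple a m S \<longleftrightarrow> finite S \<and> card S = m \<and> (\<forall>x\<in>S. x > 0) \<and>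
     (\<forall>x\<in>S. \<forall>y\<in>S. x \<noteq> y \<longrightarrow> is_square (int x * int y + a))"

end

theory Submission
  imports Defs
begin

text \<open>
  Multiplication by \<open>8\<close> and completion of squares turn ``\<open>T\<^sub>n T\<^sub>m + a\<close> is a square'' into a Pell-type
  equation. With \<open>N = 2 n + 1\<close>, \<open>M = 2 m + 1\<close> and \<open>T\<^sub>n T\<^sub>m + a = r\<^sup>2\<close> one has
  \<open>(8 r)\<^sup>2 - (N\<^sup>2 - 1) M\<^sup>2 = 64 a - (N\<^sup>2 - 1)\<close>,
  and multiplying \<open>8 r + M \<surd>(N\<^sup>2 - 1)\<close> by the unit \<open>N + \<surd>(N\<^sup>2 - 1)\<close> gives a new solution, in which
  \<open>M\<close> is replaced by the odd number \<open>N M + 8 r = 2 l + 1\<close>. So \<open>T\<^sub>n T\<^sub>l + a\<close> is again a square.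

  The decisive point is that consecutive solutions are compatible: \<open>T\<^sub>m T\<^sub>l + a\<close> is the square of
  \<open>N T\<^sub>m + M r\<close>, identically in \<open>n\<close>, \<open>m\<close> and \<open>r\<close>. Both facts form \<open>triangle_pair_extension\<close>.
  For \<open>r \<ge> 0\<close> the index \<open>l\<close> exceeds \<open>n\<close> and \<open>m\<close>, so \<open>{T\<^sub>n, T\<^sub>m, T\<^sub>l}\<close> is a triple and the step can be
  repeated from \<open>{T\<^sub>n, T\<^sub>l}\<close>; the indices increase for ever, and a finite family of triples could not
  contain all the triangular numbers that arise.
\<close>

lemma eight_triangle_plus_1: "8 * int (triangle n) + 1 = (2 * int n + 1)\<^sup>2"
proof (induction n)
  case (Suc n)
  then show ?case by (simp add: power2_eq_square algebra_simps)
qed simp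

lemma strict_mono_triangle: "strict_mono triangle"
  by (rule strict_mono_Suc_iff[THEN iffD2]) simp

lemma triangle_eq_iff: "triangle m = triangle n \<longleftrightarrow> m = n"
  using strict_mono_triangle by (rule strict_mono_eq)

lemma triangle_pos: "n \<ge> 1 \<Longrightarrow> triangle n > 0"
  using strict_monoD[OF strict_mono_triangle, of 0 n] by simp

text \<open>The index \<open>l\<close> is chosen so that \<open>2 l + 1 = (2 n + 1) (2 m + 1) + 8 r\<close>, the unit step of the
  Pell-type equation. Squaring this relation expresses \<open>T\<^sub>l\<close> as a polynomial in \<open>T\<^sub>n\<close>, \<open>T\<^sub>m\<close>, \<open>N\<close>, \<open>M\<close> and \<open>r\<close>;
  after \<open>a\<close> is eliminated as \<open>r\<^sup>2 - T\<^sub>n T\<^sub>m\<close>, both claims are polynomial identities modulo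
  \<open>N\<^sup>2 = 8 T\<^sub>n + 1\<close> and \<open>M\<^sup>2 = 8 T\<^sub>m + 1\<close>.\<close>

lemma triangle_pair_extension:
  fixes a :: int and n m r :: nat
  assumes r: "int (triangle n) * int (triangle m) + a = (int r)\<^sup>2"
  defines "l \<equiv> 2 * n * m + n + m + 4 * r"
  shows "is_square (int (triangle n) * int (triangle l) + a)"
    and "is_square (int (triangle m) * int (triangle l) + a)"
proof -
  define A B C where "A = int (triangle n)" and "B = int (triangle m)" and "C = int (triangle l)"
  define N M R where "N = 2 * int n + 1" and "M = 2 * int m + 1" and "R = int r"
  have N: "N\<^sup>2 = 8 * A + 1" and M: "M\<^sup>2 = 8 * B + 1"
    by (simp_all only: A_def B_def N_def M_def eight_triangle_plus_1)
  have a: "a = R\<^sup>2 - A * B"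
    using r by (simp add: A_def B_def R_def)
  have "8 * C + 1 = (N * M + 8 * R)\<^sup>2"
    unfolding C_def eight_triangle_plus_1 l_def N_def M_def R_def
    by (rule arg_cong[where f = "\<lambda>x. x\<^sup>2"]) (simp add: algebra_simps)
  also have "\<dots> = N\<^sup>2 * M\<^sup>2 + 16 * N * M * R + 64 * R\<^sup>2"
    by (simp add: power2_eq_square algebra_simps)
  also have "\<dots> = 8 * (A + N\<^sup>2 * B + 2 * N * M * R + 8 * R\<^sup>2) + 1"
    by (simp add: N M algebra_simps)
  finally have C: "C = A + N\<^sup>2 * B + 2 * N * M * R + 8 * R\<^sup>2"
    by simp
  have "A * C + a = (N * R + A * M)\<^sup>2"
    using N M unfolding C a by algebra
  then show "is_square (int (triangle n) * int (triangle l) + a)"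
    unfolding A_def C_def by (metis is_nth_powerI)
  have "B * C + a = (N * B + M * R)\<^sup>2"
    using M unfolding C a by algebra
  then show "is_square (int (triangle m) * int (triangle l) + a)"
    unfolding B_def C_def by (metis is_nth_powerI)
qed

lemma is_square_int_natE:
  assumes "is_square (x :: int)"
  obtains r :: nat where "x = (int r)\<^sup>2"
proof -
  from assms obtain s where "x = s\<^sup>2"
    by (auto elim: is_nth_powerE)
  then have "x = (int (nat \<bar>s\<bar>))\<^sup>2"
    by simp
  then show thesis by (rule that)
qed

lemma D_tuple_3I:
  assumes "x > 0" "y > 0" "z > 0" "x \<noteq> y" "x \<noteq> z" "y \<noteq> z"
    and "is_square (int x * int y + a)" "is_square (int x * int z + a)"
      "is_square (int y * int z + a)"
  shows "D_tuple a 3 {x, y, z}"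
  using assms by (auto simp: D_tuple_def mult.commute)

theorem theorem1:
  fixes a :: int and n :: nat
  assumes "a \<noteq> 0" and "n \<ge> 1"
    and "\<exists>m\<ge>1. D_tuple a 2 {triangle n, triangle m}"
  shows "infinite {S. D_tuple a 3 S \<and> triangle n \<in> S \<and> (\<forall>x\<in>S. \<exists>k\<ge>1. x = triangle k)}"
    (is "infinite ?F")
proof
  assume fin: "finite ?F"
  define P where "P = {m. m \<ge> 1 \<and> m \<noteq> n \<and> is_square (int (triangle n) * int (triangle m) + a)}"
  have step: "\<exists>l>m. l \<in> P \<and> {triangle n, triangle m, triangle l} \<in> ?F" if "m \<in> P" for m
  proof -
    from that have m: "m \<ge> 1" "m \<noteq> n" and sq: "is_square (int (triangle n) * int (triangle m) + a)"
      by (auto simp: P_def)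
    from sq obtain r :: nat where r: "int (triangle n) * int (triangle m) + a = (int r)\<^sup>2"
      by (rule is_square_int_natE)
    define l where "l = 2 * n * m + n + m + 4 * r"
    have l: "l > m" "l > n"
      using m \<open>n \<ge> 1\<close> by (auto simp: l_def)
    have sq': "is_square (int (triangle n) * int (triangle l) + a)"
      "is_square (int (triangle m) * int (triangle l) + a)"
      using triangle_pair_extension[OF r] by (simp_all add: l_def)
    have "D_tuple a 3 {triangle n, triangle m, triangle l}"
      using m l \<open>n \<ge> 1\<close> sq sq' by (intro D_tuple_3I) (auto simp: triangle_eq_iff triangle_pos)
    moreover have "\<forall>x\<in>{triangle n, triangle m, triangle l}. \<exists>k\<ge>1. x = triangle k"
      using m l \<open>n \<ge> 1\<close> by (auto simp: triangle_eq_iff)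
    moreover have "l \<in> P"
      using l sq' by (auto simp: P_def)
    ultimately show ?thesis
      using l by blast
  qed
  from assms(3) obtain m where "m \<ge> 1" and D: "D_tuple a 2 {triangle n, triangle m}"
    by blast
  moreover have "m \<noteq> n"
    using D by (auto simp: D_tuple_def)
  ultimately have "m \<in> P"
    by (auto simp: P_def D_tuple_def triangle_eq_iff)
  then have "infinite P"
    using step by (metis Max_ge Max_in empty_iff leD)
  then have "infinite (triangle ` P)"
    by (simp add: finite_image_iff inj_on_def triangle_eq_iff)
  moreover have "triangle ` P \<subseteq> \<Union> ?F"
    using step by blast
  moreover have "finite (\<Union> ?F)"
    using fin by (auto simp: D_tuple_def)
  ultimately show False
    by (meson finite_subset)
qed

end
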